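(* For all $p>1$ and $x\in (0,1)$ the following four inequalities hold: $$\operatorname{arctanh}_p(x) < \frac x2 \left( 1 - \frac2p\, \log\big(1-x^{\frac p2}\big) + \frac{2^{\frac2p}\,b_{p/2}}{(1+x^{\frac p2})^{\frac2p}}\right),$$ $$\arctan_p(x) < x\left( 1- \frac1{p(1+p)}\, \log(1-x^p) - \frac1p\,\log (1+x^p) \right),$$ $$\operatorname{arctanh}_p(x) > \frac x2 \left( 1 - \frac2{2+p}\, \log\big(1-x^{\frac p2}\big) + \frac{p (2+p)(1+x^{\frac p2}) + 4x^{\frac p2}}{p (2+p)(1+x^{\frac p2})^{1+\frac2p}} \right),$$ $$\arctan_p(x) > x \left( 1 + \frac1{p(1+p)}\, \log\big(1-x^p\big) - \frac2{1+2p}\, \log(1+x^p)\right),$$ where, for $s>0$, $$b_s = \frac1{2s}\left( \psi\left( \frac{1+s}{2s}\right) - \psi\left(\frac1{2s}\right)\right).$$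
   Context: For real $p>0$ and $x\in(0,1)$, define $$\arctan_p(x)=\int_0^x(1+t^p)^{-1}\,dt,\qquad \operatorname{arctanh}_p(x)=\int_0^x(1-t^p)^{-1}\,dt.$$ $\psi(x)=\Gamma'(x)/\Gamma(x)$, $x>0$, is the digamma function. *)

theory Defs
  imports "HOL-Analysis.Analysis"
begin

(* Intended for p > 0, 0 < x < 1 and (below) s > 0; the total functions are not restricted to these ranges. *)

definition arctan_p :: "real \<Rightarrow> real \<Rightarrow> real" where
  "arctan_p p x = integral {0..x} (\<lambda>t. inverse (1 + t powr p))"

definition arctanh_p :: "real \<Rightarrow> real \<Rightarrow> real" where
  "arctanh_p p x = integral {0..x} (\<lambda>t. inverse (1 - t powr p))"

(* The library defines Digamma by a series; on the positive reals it is the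
   logarithmic derivative of Gamma. *)
lemma Digamma_eq_deriv_Gamma_over_Gamma:
  fixes x :: real
  assumes "x > 0"
  shows "Digamma x = deriv Gamma x / Gamma x"
proof -
  have "x \<notin> \<int>\<^sub>\<le>\<^sub>0"
    using assms by (auto elim!: nonpos_Ints_cases)
  then have "(Gamma has_field_derivative Gamma x * Digamma x) (at x)"
    by (rule has_field_derivative_Gamma)
  then have "deriv Gamma x = Gamma x * Digamma x"
    by (rule DERIV_imp_deriv)
  moreover have "Gamma x > 0"
    using assms by (rule Gamma_real_pos)
  ultimately show ?thesis by simp
qed

definition b_const :: "real \<Rightarrow> real" where
  "b_const s = 1 / (2 * s) * (Digamma ((1 + s) / (2 * s)) - Digamma (1 / (2 * s)))"

end

theory Submission
  imports Defs
begin

text \<open>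
  With one exception, the bounds on \<^term>\<open>arctan_p q\<close> and \<^term>\<open>arctanh_p q\<close> come from
  comparing derivatives. They have the form \<^term>\<open>x * G (x powr q)\<close>. In the variable \<open>u = x powr q\<close> the derivative of such a product is
  \<open>G u + q * u * G' u\<close>, so a strict pointwise comparison of this expression with
  \<open>1 / (1 + u)\<close> or \<open>1 / (1 - u)\<close>, together with equality at \<open>x = 0\<close>, proves the bound
  (\<open>times_powr_less_primitive\<close>, \<open>primitive_less_times_powr\<close>). In every case the rational terms
  cancel to leave an elementary inequality such as \<open>u / (1 + u) < ln (1 + u) < u\<close>.

  The two bounds on \<^term>\<open>arctan_p p\<close> come directly from this. For \<^term>\<open>arctanh_p p\<close>, put
  \<open>q = p / 2\<close>; the partial fractions
  \<open>2 / (1 - v\<^sup>2) = 1 / (1 - v) + 1 / (1 + v)\<close> with \<open>v = t powr q\<close> express it as the mean of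
  \<^term>\<open>arctanh_p q\<close> and \<^term>\<open>arctan_p q\<close> (\<open>arctanh_p_split\<close>). The former has logarithmic
  bounds and the latter algebraic ones, and adding them gives exactly the two claimed estimates.

  The exceptional bound is the one with the constant (\<open>arctan_p_less_powr\<close>). It says that the
  quotient of \<^term>\<open>arctan_p q x\<close> by \<open>x / (1 + x powr q) powr (1 / q)\<close> is below its value at
  \<open>x = 1\<close>, and it holds because the quotient of the derivatives, \<open>(1 + x powr q) powr (1 / q)\<close>,
  is increasing. The value at 1 involves \<^term>\<open>arctan_p q 1\<close>, which is the alternating
  series of the reciprocals of \<open>n * q + 1\<close>; the series of the digamma function sums it to
  \<^term>\<open>b_const q\<close> (\<open>arctan_p_one_eq_b_const\<close>).
\<close>

section \<open>Comparison of primitives\<close>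

lemma increment_less_if_deriv_less:
  fixes f g :: "real \<Rightarrow> real"
  assumes "a < b" "continuous_on {a..b} f" "continuous_on {a..b} g"
    and "\<And>t. a < t \<Longrightarrow> t < b \<Longrightarrow> (f has_real_derivative f' t) (at t)"
    and "\<And>t. a < t \<Longrightarrow> t < b \<Longrightarrow> (g has_real_derivative g' t) (at t)"
    and "\<And>t. a < t \<Longrightarrow> t < b \<Longrightarrow> f' t < g' t"
  shows "f b - f a < g b - g a"
proof -
  have "(\<lambda>t. g t - f t) a < (\<lambda>t. g t - f t) b"
  proof (rule DERIV_pos_imp_increasing_open[OF assms(1)])
    fix t assume t: "a < t" "t < b"
    have "((\<lambda>t. g t - f t) has_real_derivative (g' t - f' t)) (at t)"
      by (intro DERIV_diff assms t)
    moreover have "g' t - f' t > 0" using assms(6)[OF t] by simp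
    ultimately show "\<exists>y. ((\<lambda>t. g t - f t) has_real_derivative y) (at t) \<and> 0 < y" by blast
  qed (intro continuous_on_diff assms)
  then show ?thesis by simp
qed

lemma continuous_on_powr_nonneg:
  fixes q :: real
  assumes "q > 0" "A \<subseteq> {0..}"
  shows "continuous_on A (\<lambda>t. t powr q)"
  using assms by (intro continuous_on_powr' continuous_intros) auto

lemma powr_less_one:
  fixes q t :: real
  assumes "q > 0" "0 \<le> t" "t < 1"
  shows "t powr q < 1"
  using powr_less_mono2[OF assms] by simp

lemma has_derivative_times_powr:
  fixes q t :: real
  assumes "t > 0" "(G has_real_derivative D) (at (t powr q))"
  shows "((\<lambda>t. t * G (t powr q)) has_real_derivative
           G (t powr q) + q * t powr q * D) (at t)"
proof -
  have "((\<lambda>t. t powr q) has_real_derivative q * t powr (q - 1)) (at t)"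
    using assms(1) by (rule has_real_derivative_powr)
  from DERIV_chain2[OF assms(2) this]
  have "((\<lambda>t. t * G (t powr q)) has_real_derivative
          1 * G (t powr q) + D * (q * t powr (q - 1)) * t) (at t)"
    by (intro DERIV_mult DERIV_ident)
  moreover have "t powr (q - 1) * t = t powr q"
    using powr_mult_base[of t "q - 1"] assms(1) by (simp add: mult.commute)
  then have "D * (q * t powr (q - 1)) * t = q * t powr q * D"
    by (metis mult.assoc mult.commute)
  ultimately show ?thesis by simp
qed

text \<open>
  The integrand \<open>\<phi>\<close> and the candidate \<open>G\<close> are taken as functions of \<open>u = t powr q\<close>, so that the
  condition to be checked in each application is a one-variable inequality free of real powers
  of \<open>t\<close>.
\<close>

lemma times_powr_less_primitive:
  fixes q x :: real
  assumes q: "q > 0" and x: "x > 0"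
    and F: "F 0 = 0" "continuous_on {0..x} F"
      "\<And>t. 0 < t \<Longrightarrow> t < x \<Longrightarrow> (F has_real_derivative \<phi> (t powr q)) (at t)"
    and G: "\<And>u. 0 \<le> u \<Longrightarrow> u \<le> x powr q \<Longrightarrow> (G has_real_derivative G' u) (at u)"
    and less: "\<And>u. 0 < u \<Longrightarrow> u < x powr q \<Longrightarrow> G u + q * u * G' u < \<phi> u"
  shows "x * G (x powr q) < F x"
proof -
  have mono: "t powr q \<le> x powr q" if "0 \<le> t" "t \<le> x" for t
    using that q by (simp add: powr_mono2)
  have "continuous_on {0..x powr q} G"
    by (intro continuous_at_imp_continuous_on ballI DERIV_isCont[OF G]) auto
  then have "continuous_on {0..x} (\<lambda>t. G (t powr q))"
    by (rule continuous_on_compose2[OF _ continuous_on_powr_nonneg[OF q]]) (auto simp: mono)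
  then have "continuous_on {0..x} (\<lambda>t. t * G (t powr q))"
    by (intro continuous_intros)
  then have "(\<lambda>t. t * G (t powr q)) x - (\<lambda>t. t * G (t powr q)) 0 < F x - F 0"
  proof (rule increment_less_if_deriv_less[OF x _ F(2)])
    fix t assume t: "0 < t" "t < x"
    show "((\<lambda>t. t * G (t powr q)) has_real_derivative
            G (t powr q) + q * t powr q * G' (t powr q)) (at t)"
      using t mono[of t] by (intro has_derivative_times_powr G) auto
    show "(F has_real_derivative \<phi> (t powr q)) (at t)" by (rule F(3)[OF t])
    show "G (t powr q) + q * t powr q * G' (t powr q) < \<phi> (t powr q)"
      using t q by (intro less) (auto simp: powr_less_mono2)
  qed
  then show ?thesis using F(1) by simp
qed

lemma primitive_less_times_powr:
  fixes q x :: real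
  assumes "q > 0" "x > 0"
    and F: "F 0 = 0" "continuous_on {0..x} F"
      "\<And>t. 0 < t \<Longrightarrow> t < x \<Longrightarrow> (F has_real_derivative \<phi> (t powr q)) (at t)"
    and G: "\<And>u. 0 \<le> u \<Longrightarrow> u \<le> x powr q \<Longrightarrow> (G has_real_derivative G' u) (at u)"
    and less: "\<And>u. 0 < u \<Longrightarrow> u < x powr q \<Longrightarrow> \<phi> u < G u + q * u * G' u"
  shows "F x < x * G (x powr q)"
proof -
  have "x * - G (x powr q) < - F x"
  proof (rule times_powr_less_primitive[where G = "\<lambda>u. - G u" and G' = "\<lambda>u. - G' u"
      and F = "\<lambda>t. - F t" and \<phi> = "\<lambda>u. - \<phi> u" and q = q])
    fix u :: real assume "0 < u" "u < x powr q"
    from less[OF this] show "- G u + q * u * - G' u < - \<phi> u" by simp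
  qed (use assms in \<open>auto intro!: continuous_intros DERIV_minus\<close>)
  then show ?thesis by simp
qed

lemma one_minus_inverse_less_ln:
  fixes x :: real
  assumes "x > 0" "x \<noteq> 1"
  shows "1 - inverse x < ln x"
proof -
  have "ln (inverse x) \<le> inverse x - 1" "ln (inverse x) \<noteq> inverse x - 1"
    using ln_le_minus_one[of "inverse x"] ln_eq_minus_one[of "inverse x"] assms by auto
  then show ?thesis using assms by (simp add: ln_inverse)
qed

lemma ln_less_minus_one:
  fixes x :: real
  assumes "x > 0" "x \<noteq> 1"
  shows "ln x < x - 1"
  using ln_le_minus_one[of x] ln_eq_minus_one[of x] assms by linarith

section \<open>The functions as primitives\<close>

lemma primitive_from_zero:
  fixes f :: "real \<Rightarrow> real"
  assumes "continuous_on {0..b} f"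
  shows "continuous_on {0..b} (\<lambda>x. integral {0..x} f)"
    and "\<And>t. 0 < t \<Longrightarrow> t < b \<Longrightarrow> ((\<lambda>x. integral {0..x} f) has_real_derivative f t) (at t)"
proof -
  show "continuous_on {0..b} (\<lambda>x. integral {0..x} f)"
    by (rule indefinite_integral_continuous_1[OF integrable_continuous_interval[OF assms]])
  fix t assume "0 < t" "t < b"
  then show "((\<lambda>x. integral {0..x} f) has_real_derivative f t) (at t)"
    using integral_has_real_derivative[OF assms, of t] at_within_Icc_at[of 0 t b] by simp
qed

lemma continuous_on_arctan_p_integrand:
  fixes q b :: real
  assumes "q > 0"
  shows "continuous_on {0..b} (\<lambda>t. inverse (1 + t powr q))"
proof (rule continuous_on_inverse)
  show "continuous_on {0..b} (\<lambda>t. 1 + t powr q)"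
    by (intro continuous_on_add continuous_on_const continuous_on_powr_nonneg assms) auto
  have "1 + t powr q \<noteq> 0" for t using powr_ge_zero[of t q] by linarith
  then show "\<forall>t\<in>{0..b}. 1 + t powr q \<noteq> 0" by blast
qed

lemma continuous_on_arctanh_p_integrand:
  fixes q b :: real
  assumes "q > 0" "b < 1"
  shows "continuous_on {0..b} (\<lambda>t. inverse (1 - t powr q))"
proof (rule continuous_on_inverse)
  show "continuous_on {0..b} (\<lambda>t. 1 - t powr q)"
    by (intro continuous_on_diff continuous_on_const continuous_on_powr_nonneg assms) auto
  show "\<forall>t\<in>{0..b}. 1 - t powr q \<noteq> 0"
  proof
    fix t assume "t \<in> {0..b}"
    then show "1 - t powr q \<noteq> 0" using powr_less_one[of q t] assms by simp
  qed
qed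

lemma arctan_p_0 [simp]: "arctan_p q 0 = 0"
  by (simp add: arctan_p_def)

lemma arctanh_p_0 [simp]: "arctanh_p q 0 = 0"
  by (simp add: arctanh_p_def)

lemma continuous_on_arctan_p: "q > 0 \<Longrightarrow> continuous_on {0..b} (arctan_p q)"
  unfolding arctan_p_def[abs_def]
  by (intro primitive_from_zero continuous_on_arctan_p_integrand)

lemma DERIV_arctan_p:
  assumes "q > 0" "t > 0"
  shows "(arctan_p q has_real_derivative inverse (1 + t powr q)) (at t)"
  unfolding arctan_p_def[abs_def]
  by (rule primitive_from_zero(2)[OF continuous_on_arctan_p_integrand[OF assms(1)], of t "t + 1"])
    (use assms in auto)

lemma continuous_on_arctanh_p: "q > 0 \<Longrightarrow> b < 1 \<Longrightarrow> continuous_on {0..b} (arctanh_p q)"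
  unfolding arctanh_p_def[abs_def]
  by (intro primitive_from_zero continuous_on_arctanh_p_integrand)

lemma DERIV_arctanh_p:
  assumes "q > 0" "0 < t" "t < 1"
  shows "(arctanh_p q has_real_derivative inverse (1 - t powr q)) (at t)"
proof -
  obtain b where "t < b" "b < 1" using dense[OF assms(3)] by blast
  then show ?thesis
    unfolding arctanh_p_def[abs_def]
    by (intro primitive_from_zero(2)[OF continuous_on_arctanh_p_integrand[OF assms(1)], of b t])
      (use assms in auto)
qed

text \<open>
  Partial fractions of \<open>1 / (1 - v\<^sup>2)\<close> with \<open>v = t powr (p / 2)\<close>.
\<close>

lemma arctanh_p_split:
  assumes "p > 0" "0 \<le> x" "x < 1"
  shows "arctanh_p p x = (arctanh_p (p / 2) x + arctan_p (p / 2) x) / 2"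
proof -
  have q: "p / 2 > 0" using assms by simp
  have I1: "(\<lambda>t. inverse (1 - t powr (p / 2))) integrable_on {0..x}"
    and I2: "(\<lambda>t. inverse (1 + t powr (p / 2))) integrable_on {0..x}"
    using q assms by (intro integrable_continuous_interval
        continuous_on_arctan_p_integrand continuous_on_arctanh_p_integrand; simp)+
  have "arctanh_p p x = integral {0..x}
      (\<lambda>t. (inverse (1 - t powr (p / 2)) + inverse (1 + t powr (p / 2))) / 2)"
    unfolding arctanh_p_def
  proof (rule integral_cong)
    fix t assume "t \<in> {0..x}"
    then have t: "0 \<le> t" "t < 1" using assms by auto
    define v where "v = t powr (p / 2)"
    have "t powr p = v\<^sup>2"
      unfolding v_def power2_eq_square powr_add[symmetric] by simp
    moreover have "0 \<le> v" "v < 1"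
      using t powr_less_one[OF q] by (auto simp: v_def)
    moreover have "v\<^sup>2 < 1" using \<open>0 \<le> v\<close> \<open>v < 1\<close> by (simp add: power_less_one_iff)
    ultimately show "inverse (1 - t powr p)
        = (inverse (1 - t powr (p / 2)) + inverse (1 + t powr (p / 2))) / 2"
      unfolding v_def[symmetric] by (simp add: divide_simps) (simp add: algebra_simps power2_eq_square)
  qed
  also have "\<dots> = (arctanh_p (p / 2) x + arctan_p (p / 2) x) / 2"
    unfolding arctanh_p_def arctan_p_def by (simp add: integral_add[OF I1 I2])
  finally show ?thesis .
qed

section \<open>Logarithmic bounds\<close>

text \<open>
  The coefficient \<open>c\<close> of \<open>- ln (1 - u)\<close> in the next two bounds contributes \<open>q * c * u / (1 - u)\<close>
  to the derivative. With \<open>c = 1 / q\<close> this already accounts for all of \<open>1 / (1 - u) - 1\<close>, and the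
  positive term \<open>- c * ln (1 - u)\<close> is the surplus.
\<close>

lemma arctanh_p_less_ln:
  assumes q: "q > 0" and x: "0 < x" "x < 1"
  shows "arctanh_p q x < x * (1 - 1 / q * ln (1 - x powr q))"
proof (rule primitive_less_times_powr[where G = "\<lambda>u. 1 - 1 / q * ln (1 - u)"
      and G' = "\<lambda>u. 1 / q * inverse (1 - u)" and \<phi> = "\<lambda>u. inverse (1 - u)" and q = q])
  note u1 = powr_less_one[OF q less_imp_le[OF x(1)] x(2)]
  fix u assume "0 \<le> u" "u \<le> x powr q"
  then show "((\<lambda>u. 1 - 1 / q * ln (1 - u)) has_real_derivative 1 / q * inverse (1 - u)) (at u)"
    using u1 q by (auto intro!: derivative_eq_intros simp: divide_inverse)
next
  fix u assume u: "0 < u" "u < x powr q"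
  then have "u < 1" using powr_less_one[OF q less_imp_le[OF x(1)] x(2)] by simp
  then have "ln (1 - u) < 0" "inverse (1 - u) = 1 + u * inverse (1 - u)"
    using u by (simp_all add: field_simps)
  moreover have "q * u * (1 / q * inverse (1 - u)) = u * inverse (1 - u)" using q by simp
  moreover have "1 / q * ln (1 - u) < 0" using q \<open>ln (1 - u) < 0\<close> by (simp add: divide_neg_pos)
  ultimately show "inverse (1 - u) < 1 - 1 / q * ln (1 - u) + q * u * (1 / q * inverse (1 - u))"
    by linarith
qed (use assms in \<open>auto intro!: continuous_on_arctanh_p DERIV_arctanh_p\<close>)

text \<open>
  With \<open>c = 1 / (1 + q)\<close> the derivative misses \<open>c * u / (1 - u)\<close>, which exceeds the logarithmic
  term \<open>- c * ln (1 - u)\<close>. This is the coefficient for which the bound agrees with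
  \<^term>\<open>arctanh_p q\<close> up to the first power of \<open>u\<close>.
\<close>

lemma arctanh_p_greater_ln:
  assumes q: "q > 0" and x: "0 < x" "x < 1"
  shows "x * (1 - 1 / (1 + q) * ln (1 - x powr q)) < arctanh_p q x"
proof (rule times_powr_less_primitive[where G = "\<lambda>u. 1 - 1 / (1 + q) * ln (1 - u)"
      and G' = "\<lambda>u. 1 / (1 + q) * inverse (1 - u)" and \<phi> = "\<lambda>u. inverse (1 - u)" and q = q])
  note u1 = powr_less_one[OF q less_imp_le[OF x(1)] x(2)]
  fix u assume "0 \<le> u" "u \<le> x powr q"
  then show "((\<lambda>u. 1 - 1 / (1 + q) * ln (1 - u)) has_real_derivative
      1 / (1 + q) * inverse (1 - u)) (at u)"
    using u1 q by (auto intro!: derivative_eq_intros simp: divide_inverse)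
next
  fix u assume u: "0 < u" "u < x powr q"
  then have "u < 1" using powr_less_one[OF q less_imp_le[OF x(1)] x(2)] by simp
  define w where "w = inverse (1 - u)"
  have w: "u * w = w - 1" using \<open>u < 1\<close> by (simp add: w_def field_simps)
  have "- ln (1 - u) < w - 1"
    using one_minus_inverse_less_ln[of "1 - u"] u \<open>u < 1\<close> by (simp add: w_def)
  then have "(1 + q) + - ln (1 - u) + q * (w - 1) < (1 + q) * w"
    by (simp add: algebra_simps)
  then have "((1 + q) + - ln (1 - u) + q * (w - 1)) / (1 + q) < w"
    using q by (simp add: pos_divide_less_eq mult.commute)
  moreover have "1 - 1 / (1 + q) * ln (1 - u) + q * u * (1 / (1 + q) * w)
      = ((1 + q) + - ln (1 - u) + q * (u * w)) / (1 + q)"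
    using q by (simp add: diff_divide_distrib add_divide_distrib)
  ultimately show "1 - 1 / (1 + q) * ln (1 - u) + q * u * (1 / (1 + q) * inverse (1 - u))
      < inverse (1 - u)"
    unfolding w_def[symmetric] w by simp
qed (use assms in \<open>auto intro!: continuous_on_arctanh_p DERIV_arctanh_p\<close>)

text \<open>
  After the terms \<open>u / (1 + u)\<close> cancel, what has to be shown is
  \<open>(1 + p) * ln (1 + u) < - ln (1 - u) + p * u / (1 - u)\<close>. It follows by comparing both sides with
  \<open>(1 + p) * u\<close>.
\<close>

lemma arctan_p_less_ln:
  assumes p: "p > 0" and x: "0 < x" "x < 1"
  shows "arctan_p p x
    < x * (1 - 1 / (p * (1 + p)) * ln (1 - x powr p) - 1 / p * ln (1 + x powr p))"
proof (rule primitive_less_times_powr[where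
      G = "\<lambda>u. 1 - 1 / (p * (1 + p)) * ln (1 - u) - 1 / p * ln (1 + u)"
      and G' = "\<lambda>u. 1 / (p * (1 + p)) * inverse (1 - u) - 1 / p * inverse (1 + u)"
      and \<phi> = "\<lambda>u. inverse (1 + u)" and q = p])
  note u1 = powr_less_one[OF p less_imp_le[OF x(1)] x(2)]
  fix u assume "0 \<le> u" "u \<le> x powr p"
  then have "1 - u > 0" "1 + u > 0" using u1 by auto
  then show "((\<lambda>u. 1 - 1 / (p * (1 + p)) * ln (1 - u) - 1 / p * ln (1 + u)) has_real_derivative
      1 / (p * (1 + p)) * inverse (1 - u) - 1 / p * inverse (1 + u)) (at u)"
    by (auto intro!: derivative_eq_intros simp: divide_inverse)
next
  fix u assume u: "0 < u" "u < x powr p"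
  then have "u < 1" using powr_less_one[OF p less_imp_le[OF x(1)] x(2)] by simp
  have L1: "ln (1 - u) < - u" using ln_less_minus_one[of "1 - u"] u \<open>u < 1\<close> by simp
  have L2: "ln (1 + u) < u" using ln_less_minus_one[of "1 + u"] u by simp
  have L3: "u * inverse (1 - u) > u" using u \<open>u < 1\<close> by (simp add: field_simps)
  have "ln (1 + u) * (1 + p) < - ln (1 - u) + p * (u * inverse (1 - u))"
  proof -
    have "p * ln (1 + u) < p * (u * inverse (1 - u))"
      using L2 L3 p by (intro mult_strict_left_mono) auto
    then show ?thesis using L1 L2 by (simp add: algebra_simps)
  qed
  then have "ln (1 + u) * (1 + p) / (p * (1 + p))
      < (- ln (1 - u) + p * (u * inverse (1 - u))) / (p * (1 + p))"
    using p by (intro divide_strict_right_mono) auto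
  moreover have "ln (1 + u) * (1 + p) / (p * (1 + p)) = 1 / p * ln (1 + u)" using p by simp
  moreover have "(- ln (1 - u) + p * (u * inverse (1 - u))) / (p * (1 + p))
      = - (1 / (p * (1 + p)) * ln (1 - u)) + p * u * (1 / (p * (1 + p)) * inverse (1 - u))"
    by (simp add: diff_divide_distrib)
  moreover have "p * u * (1 / (p * (1 + p)) * inverse (1 - u) - 1 / p * inverse (1 + u))
     = p * u * (1 / (p * (1 + p)) * inverse (1 - u)) - u * inverse (1 + u)"
    using p by (simp add: algebra_simps)
  moreover have "inverse (1 + u) = 1 - u * inverse (1 + u)"
    using u by (simp add: field_simps)
  ultimately show "inverse (1 + u)
      < 1 - 1 / (p * (1 + p)) * ln (1 - u) - 1 / p * ln (1 + u)
        + p * u * (1 / (p * (1 + p)) * inverse (1 - u) - 1 / p * inverse (1 + u))"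
    by linarith
qed (use assms in \<open>auto intro!: continuous_on_arctan_p DERIV_arctan_p\<close>)

text \<open>
  Both logarithmic terms are negative here. The remaining rational terms are
  \<open>u / ((1 + 2 * p) * (1 + u)) - u / ((1 + p) * (1 - u))\<close>, the first of them because
  \<open>2 * p / (1 + 2 * p)\<close> falls short of 1 by \<open>1 / (1 + 2 * p)\<close>. Their sum is negative too, as
  both factors in the first denominator are the larger ones.
\<close>

lemma arctan_p_greater_ln:
  assumes p: "p > 0" and x: "0 < x" "x < 1"
  shows "x * (1 + 1 / (p * (1 + p)) * ln (1 - x powr p) - 2 / (1 + 2 * p) * ln (1 + x powr p))
    < arctan_p p x"
proof (rule times_powr_less_primitive[where
      G = "\<lambda>u. 1 + 1 / (p * (1 + p)) * ln (1 - u) - 2 / (1 + 2 * p) * ln (1 + u)"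
      and G' = "\<lambda>u. - (1 / (p * (1 + p)) * inverse (1 - u)) - 2 / (1 + 2 * p) * inverse (1 + u)"
      and \<phi> = "\<lambda>u. inverse (1 + u)" and q = p])
  note u1 = powr_less_one[OF p less_imp_le[OF x(1)] x(2)]
  fix u assume "0 \<le> u" "u \<le> x powr p"
  then have "1 - u > 0" "1 + u > 0" using u1 by auto
  then show "((\<lambda>u. 1 + 1 / (p * (1 + p)) * ln (1 - u) - 2 / (1 + 2 * p) * ln (1 + u))
      has_real_derivative
      - (1 / (p * (1 + p)) * inverse (1 - u)) - 2 / (1 + 2 * p) * inverse (1 + u)) (at u)"
    by (auto intro!: derivative_eq_intros simp: divide_inverse)
next
  fix u assume u: "0 < u" "u < x powr p"
  then have "u < 1" using powr_less_one[OF p less_imp_le[OF x(1)] x(2)] by simp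
  have L1: "1 / (p * (1 + p)) * ln (1 - u) < 0"
    using p u \<open>u < 1\<close> by (intro mult_pos_neg) auto
  have L2: "2 / (1 + 2 * p) * ln (1 + u) > 0"
    using p u by (intro mult_pos_pos) auto
  have "1 / (1 + 2 * p) * (u * inverse (1 + u)) < 1 / (1 + p) * (u * inverse (1 - u))"
  proof (rule mult_strict_mono)
    show "1 / (1 + 2 * p) < 1 / (1 + p)" using p by (intro divide_strict_left_mono) auto
    show "u * inverse (1 + u) < u * inverse (1 - u)"
      using u \<open>u < 1\<close> by (intro mult_strict_left_mono less_imp_inverse_less) auto
  qed (use p u in auto)
  moreover have "p * u * (1 / (p * (1 + p)) * inverse (1 - u)) = 1 / (1 + p) * (u * inverse (1 - u))"
    using p by simp
  moreover have "2 * p / (1 + 2 * p) = 1 - 1 / (1 + 2 * p)"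
    using p by (simp add: field_simps)
  then have "p * u * (2 / (1 + 2 * p) * inverse (1 + u))
      = (1 - 1 / (1 + 2 * p)) * (u * inverse (1 + u))"
    by (simp add: mult_ac flip: times_divide_eq_right)
  moreover have "inverse (1 + u) = 1 - u * inverse (1 + u)"
    using u by (simp add: field_simps)
  ultimately show "1 + 1 / (p * (1 + p)) * ln (1 - u) - 2 / (1 + 2 * p) * ln (1 + u)
       + p * u * (- (1 / (p * (1 + p)) * inverse (1 - u)) - 2 / (1 + 2 * p) * inverse (1 + u))
      < inverse (1 + u)"
    using L1 L2 unfolding left_diff_distrib right_diff_distrib mult_minus_right by linarith
qed (use assms in \<open>auto intro!: continuous_on_arctan_p DERIV_arctan_p\<close>)

section \<open>Algebraic bounds\<close>

text \<open>
  By Pfaff's transformation, \<open>arctan_p q x / x\<close> is \<open>(1 + u) powr (- 1 / q)\<close> times a hypergeometric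
  series in \<open>u / (1 + u)\<close> with positive coefficients; the bound keeps its first two terms. The
  derivative of the bound collapses to
  \<open>(1 + u) powr (- 1 / q) * (1 + 1 / q * (u / (1 + u))) / (1 + u)\<close>, so all that is needed is
  \<open>1 + a * v < (1 + u) powr a\<close> for \<open>a = 1 / q\<close> and \<open>v = u / (1 + u)\<close>. This follows from
  \<open>v < ln (1 + u)\<close> and the convexity of the exponential function.
\<close>

lemma arctan_p_greater_powr:
  assumes q: "q > 0" and x: "0 < x"
  shows "x * ((1 + x powr q) powr (- 1 / q) * (1 + x powr q / (q * (1 + q) * (1 + x powr q))))
    < arctan_p q x"
proof (rule times_powr_less_primitive[where
      G = "\<lambda>u. (1 + u) powr (- 1 / q) * (1 + u / (q * (1 + q) * (1 + u)))"
      and G' = "\<lambda>u. - 1 / q * (1 + u) powr (- 1 / q - 1) * (1 + u / (q * (1 + q) * (1 + u)))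
        + 1 / (q * (1 + q) * (1 + u)\<^sup>2) * (1 + u) powr (- 1 / q)"
      and \<phi> = "\<lambda>u. inverse (1 + u)" and q = q])
  fix u :: real assume "0 \<le> u"
  then have D1: "((\<lambda>u. (1 + u) powr (- 1 / q)) has_real_derivative
      - 1 / q * (1 + u) powr (- 1 / q - 1)) (at u)"
    by (auto intro!: derivative_eq_intros)
  have D2: "((\<lambda>u. 1 + u / (q * (1 + q) * (1 + u))) has_real_derivative
      1 / (q * (1 + q) * (1 + u)\<^sup>2)) (at u)"
  proof -
    define K where "K = q * (1 + q)"
    have K: "K \<noteq> 0" "1 + u \<noteq> 0" using q \<open>0 \<le> u\<close> by (auto simp: K_def)
    have "((\<lambda>u. 1 + u / (K * (1 + u))) has_real_derivative
        0 + (1 * (K * (1 + u)) - u * (K * (0 + 1))) / (K * (1 + u) * (K * (1 + u)))) (at u)"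
      by (intro DERIV_add DERIV_const DERIV_divide DERIV_ident DERIV_cmult) (use K in auto)
    moreover have "0 + (1 * (K * (1 + u)) - u * (K * (0 + 1))) / (K * (1 + u) * (K * (1 + u)))
        = 1 / (K * (1 + u)\<^sup>2)"
      using K by (simp add: divide_simps power2_eq_square) (simp add: algebra_simps)
    ultimately show ?thesis by (simp add: K_def)
  qed
  show "((\<lambda>u. (1 + u) powr (- 1 / q) * (1 + u / (q * (1 + q) * (1 + u)))) has_real_derivative
        - 1 / q * (1 + u) powr (- 1 / q - 1) * (1 + u / (q * (1 + q) * (1 + u)))
        + 1 / (q * (1 + q) * (1 + u)\<^sup>2) * (1 + u) powr (- 1 / q)) (at u)"
    by (rule DERIV_mult[OF D1 D2])
next
  fix u :: real assume u: "0 < u"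
  define P where "P = (1 + u) powr (- 1 / q)"
  have P1: "(1 + u) powr (- 1 / q - 1) = P / (1 + u)"
    using u by (simp add: P_def powr_diff)
  have "P > 0" using u by (simp add: P_def)
  have "1 + 1 / q * (u / (1 + u)) < inverse P"
  proof -
    have "1 + 1 / q * (u / (1 + u)) \<le> exp (1 / q * (u / (1 + u)))" by (rule exp_ge_add_one_self)
    also have "\<dots> < exp (1 / q * ln (1 + u))"
    proof -
      have "u / (1 + u) < ln (1 + u)"
        using one_minus_inverse_less_ln[of "1 + u"] u by (simp add: field_simps)
      then show ?thesis unfolding exp_less_cancel_iff using q by (intro mult_strict_left_mono) auto
    qed
    also have "\<dots> = inverse P"
      using u by (simp add: P_def powr_def exp_minus)
    finally show ?thesis .
  qed
  then have "P * (1 + 1 / q * (u / (1 + u))) < P * inverse P"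
    using \<open>P > 0\<close> by (rule mult_strict_left_mono)
  then have "P * (1 + 1 / q * (u / (1 + u))) / (1 + u) < 1 / (1 + u)"
    using \<open>P > 0\<close> u by (intro divide_strict_right_mono) auto
  moreover have "P * (1 + u / (q * (1 + q) * (1 + u)))
      + q * u * (- 1 / q * (P / (1 + u)) * (1 + u / (q * (1 + q) * (1 + u)))
                 + 1 / (q * (1 + q) * (1 + u)\<^sup>2) * P)
      = P * (1 + 1 / q * (u / (1 + u))) / (1 + u)"
  proof -
    have "q > 0" "1 + q > 0" "1 + u > 0" using q u by auto
    then show ?thesis
      by (simp add: divide_simps power2_eq_square) (simp add: algebra_simps)
  qed
  ultimately show "(1 + u) powr (- 1 / q) * (1 + u / (q * (1 + q) * (1 + u)))
      + q * u * (- 1 / q * (1 + u) powr (- 1 / q - 1) * (1 + u / (q * (1 + q) * (1 + u)))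
                 + 1 / (q * (1 + q) * (1 + u)\<^sup>2) * (1 + u) powr (- 1 / q)) < inverse (1 + u)"
    unfolding P1 P_def[symmetric] by (simp add: inverse_eq_divide)
qed (use assms in \<open>auto intro!: continuous_on_arctan_p DERIV_arctan_p\<close>)

lemma arctan_p_less_self:
  assumes "q > 0" "0 < x"
  shows "arctan_p q x < x"
proof -
  have "arctan_p q x < x * 1"
    by (rule primitive_less_times_powr[where G = "\<lambda>u. 1" and G' = "\<lambda>u. 0"
        and \<phi> = "\<lambda>u. inverse (1 + u)" and q = q])
      (use assms in \<open>auto intro!: continuous_on_arctan_p DERIV_arctan_p simp: inverse_less_1_iff\<close>)
  then show ?thesis by simp
qed

text \<open>
  A case of the monotone form of l'Hospital's rule: if \<open>f\<close> and \<open>h\<close> vanish at 0, \<open>f' = k * h'\<close>,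
  \<open>h' > 0\<close> and \<open>k\<close> is increasing, then \<open>f / h\<close> is increasing. Here \<open>f\<close> is \<^term>\<open>arctan_p q\<close>.
  The proof compares the increments of \<open>f\<close> with those of \<open>h\<close> on both sides of \<open>x\<close>:
  \<open>f x < k x * h x\<close> before and \<open>f 1 - f x > k x * (h 1 - h x)\<close> after. Eliminating \<open>k x\<close>
  leaves \<open>f x * h 1 < f 1 * h x\<close>.
\<close>

lemma arctan_p_less_powr:
  assumes q: "q > 0" and x: "0 < x" "x < 1"
  shows "arctan_p q x < x * (2 powr (1 / q) * arctan_p q 1 / (1 + x powr q) powr (1 / q))"
proof -
  define h where "h t = t * (1 + t powr q) powr (- 1 / q)" for t
  define k where "k t = (1 + t powr q) powr (1 / q)" for t :: real
  have hpos: "h x > 0" using x powr_ge_zero[of x q] unfolding h_def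
    by (intro mult_pos_pos) (auto simp: add_nonneg_eq_0_iff)
  have kh: "k x * h x = x"
  proof -
    have "1 + x powr q \<noteq> 0" using powr_ge_zero[of x q] by linarith
    then show ?thesis by (simp add: k_def h_def powr_minus)
  qed
  have D: "(h has_real_derivative inverse (1 + t powr q) / k t) (at t)" if t: "t > 0" for t
  proof -
    let ?u = "t powr q"
    have u: "1 + ?u > 0" by (simp add: add_pos_nonneg)
    then have "((\<lambda>u. (1 + u) powr (- 1 / q)) has_real_derivative
        - 1 / q * (1 + ?u) powr (- 1 / q - 1)) (at ?u)"
      by (auto intro!: derivative_eq_intros)
    from has_derivative_times_powr[OF t this]
    have "(h has_real_derivative (1 + ?u) powr (- 1 / q)
        + q * ?u * (- 1 / q * (1 + ?u) powr (- 1 / q - 1))) (at t)"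
      unfolding h_def .
    moreover have "(1 + ?u) powr (- 1 / q) + q * ?u * (- 1 / q * (1 + ?u) powr (- 1 / q - 1))
        = inverse (1 + ?u) / k t"
    proof -
      define W where "W = (1 + ?u) powr (- 1 / q) / (1 + ?u)"
      have "(1 + ?u) powr (- 1 / q - 1) = W" using u by (simp add: W_def powr_diff)
      moreover have "inverse (1 + ?u) / k t = W"
        by (simp add: W_def k_def powr_minus divide_inverse mult.commute)
      moreover have "(1 + ?u) powr (- 1 / q) = (1 + ?u) * W" using u by (simp add: W_def)
      moreover have "(1 + ?u) * W + q * ?u * (- 1 / q * W) = W"
        using q by (simp add: algebra_simps)
      ultimately show ?thesis by (simp only:)
    qed
    ultimately show ?thesis by simp
  qed
  have "k x * h 1 - k x * h x < arctan_p q 1 - arctan_p q x"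
  proof (rule increment_less_if_deriv_less[where f' = "\<lambda>t. k x * (inverse (1 + t powr q) / k t)"
        and g' = "\<lambda>t. inverse (1 + t powr q)"])
    show "continuous_on {x..1} (\<lambda>t. k x * h t)"
      by (intro continuous_intros continuous_at_imp_continuous_on ballI DERIV_isCont[OF D])
        (use x in auto)
    show "continuous_on {x..1} (arctan_p q)"
      by (rule continuous_on_subset[OF continuous_on_arctan_p[OF q, of 1]]) (use x in auto)
    fix t assume t: "x < t" "t < 1"
    show "((\<lambda>t. k x * h t) has_real_derivative k x * (inverse (1 + t powr q) / k t)) (at t)"
      by (intro DERIV_cmult D) (use x t in auto)
    show "(arctan_p q has_real_derivative inverse (1 + t powr q)) (at t)"
      by (rule DERIV_arctan_p) (use q x t in auto)
    have "k x < k t" unfolding k_def using q x t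
      by (intro powr_less_mono2 add_strict_left_mono) (auto simp: add_nonneg_nonneg)
    moreover have "1 + t powr q \<noteq> 0" using powr_ge_zero[of t q] by linarith
    then have "k t > 0" by (simp add: k_def)
    moreover have "inverse (1 + t powr q) > 0" by (simp add: add_pos_nonneg)
    ultimately show "k x * (inverse (1 + t powr q) / k t) < inverse (1 + t powr q)"
      by (simp only: times_divide_eq_right pos_divide_less_eq mult.commute[of "k x"])
        (rule mult_strict_left_mono)
  qed (use x in auto)
  then have A: "arctan_p q x + k x * (h 1 - h x) < arctan_p q 1" by (simp add: algebra_simps)
  have "h x < h 1"
  proof (rule DERIV_pos_imp_increasing[OF x(2)])
    fix t assume "x \<le> t"
    then have "t > 0" using x by simp
    moreover have "1 + t powr q > 0" by (simp add: add_pos_nonneg)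
    then have "0 < inverse (1 + t powr q) / k t" by (simp add: k_def)
    ultimately show "\<exists>y. (h has_real_derivative y) (at t) \<and> 0 < y" using D by blast
  qed
  \<comment> \<open>As \<open>k x * h x = x\<close>, the comparison on the left of \<open>x\<close> is just \<open>arctan_p q x < x\<close>.\<close>
  have "arctan_p q x * (h 1 - h x) < (k x * h x) * (h 1 - h x)"
    using arctan_p_less_self[OF q x(1)] \<open>h x < h 1\<close> unfolding kh
    by (intro mult_strict_right_mono) auto
  also have "\<dots> < (arctan_p q 1 - arctan_p q x) * h x"
    using mult_strict_right_mono[OF A hpos] by (simp add: algebra_simps)
  finally have "arctan_p q x * h 1 < arctan_p q 1 * h x" by (simp add: algebra_simps)
  moreover have "h 1 = inverse (2 powr (1 / q))" by (simp add: h_def powr_minus)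
  moreover have "h x = x / (1 + x powr q) powr (1 / q)"
    by (simp add: h_def powr_minus divide_inverse)
  ultimately show ?thesis by (simp add: field_simps)
qed

section \<open>The constant\<close>

text \<open>
  Integrating the finite geometric sum in \<open>- (t powr q)\<close> over the unit interval leaves the integral
  of \<open>t powr (2 * N * q) / (1 + t powr q)\<close> as error. An explicit error term replaces any
  interchange of limit and integral, which would be delicate at \<open>t = 1\<close>. An even number of terms
  makes the error nonnegative and matches the pairing of the two digamma series below.
\<close>

lemma arctan_p_one_partial_sum:
  assumes q: "q > 0"
  shows "\<bar>arctan_p q 1 - (\<Sum>n<2*N. (- 1) ^ n / (real n * q + 1))\<bar> \<le> 1 / (2 * real N * q + 1)"
proof -
  have pw: "((\<lambda>t. t powr (real n * q)) has_integral 1 / (real n * q + 1)) {0..1}" for n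
  proof -
    have "real n * q > - 1" using q by (intro less_le_trans[OF _ mult_nonneg_nonneg]) auto
    then show ?thesis using has_integral_powr_from_0[of "real n * q" 1] by simp
  qed
  have S: "((\<lambda>t. \<Sum>n<2*N. (- 1) ^ n * t powr (real n * q)) has_integral
      (\<Sum>n<2*N. (- 1) ^ n * (1 / (real n * q + 1)))) {0..1}"
    by (intro has_integral_sum has_integral_mult_right pw) auto
  have A: "((\<lambda>t. inverse (1 + t powr q)) has_integral arctan_p q 1) {0..1}"
    unfolding arctan_p_def
    by (intro integrable_integral integrable_continuous_interval continuous_on_arctan_p_integrand q)
  note diff = has_integral_diff[OF A S]
  \<comment> \<open>At \<open>t = 0\<close> the term \<open>n = 0\<close> of the sum is \<open>0 powr 0 = 0\<close>, so that point is excluded.\<close>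
  have eq: "inverse (1 + t powr q) - (\<Sum>n<2*N. (- 1) ^ n * t powr (real n * q))
      = t powr (real (2*N) * q) * inverse (1 + t powr q)" if "t > 0" for t
  proof -
    let ?v = "t powr q"
    have pn: "t powr (real n * q) = ?v ^ n" for n
      using that by (simp add: powr_powr powr_realpow[symmetric] mult.commute)
    have "(\<Sum>n<2*N. (- 1) ^ n * t powr (real n * q)) = (\<Sum>n<2*N. (- ?v) ^ n)"
      by (simp add: pn power_mult_distrib[symmetric])
    also have "\<dots> = (1 - ?v ^ (2*N)) / (1 + ?v)"
    proof -
      have "- ?v \<noteq> 1" using powr_ge_zero[of t q] by linarith
      then show ?thesis by (simp add: geometric_sum sum_gp_strict power_mult)
    qed
    finally have "(\<Sum>n<2*N. (- 1) ^ n * t powr (real n * q)) = (1 - ?v ^ (2*N)) / (1 + ?v)" .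
    then show ?thesis unfolding pn[of "2*N"]
      by (simp add: left_diff_distrib divide_inverse)
  qed
  have neg: "negligible {0::real}" by simp
  have R: "((\<lambda>t. t powr (real (2*N) * q) * inverse (1 + t powr q)) has_integral
      (arctan_p q 1 - (\<Sum>n<2*N. (- 1) ^ n * (1 / (real n * q + 1))))) {0..1}"
    by (rule has_integral_spike[OF neg _ diff]) (use eq in auto)
  have "0 \<le> arctan_p q 1 - (\<Sum>n<2*N. (- 1) ^ n * (1 / (real n * q + 1)))"
    by (rule has_integral_nonneg[OF R]) auto
  moreover have "arctan_p q 1 - (\<Sum>n<2*N. (- 1) ^ n * (1 / (real n * q + 1)))
      \<le> 1 / (real (2*N) * q + 1)"
    by (rule has_integral_le[OF R pw[of "2*N"]])
      (auto simp: mult_left_le inverse_le_1_iff add_pos_nonneg)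
  ultimately show ?thesis by simp
qed

text \<open>
  Put \<open>a = 1 / (2 * q)\<close>. In \<open>Digamma (a + 1/2) - Digamma a\<close> the logarithms of the limit formula
  cancel, and what is left pairs \<open>1 / (a + n)\<close> with \<open>1 / (a + 1/2 + n)\<close>. After scaling by
  \<open>1 / (2 * q)\<close> these are the terms \<open>2 * n\<close> and \<open>2 * n + 1\<close> of the alternating series for
  \<^term>\<open>arctan_p q 1\<close>.
\<close>

lemma arctan_p_one_eq_b_const:
  assumes q: "q > 0"
  shows "b_const q = arctan_p q 1"
proof -
  define a where "a = 1 / (2 * q)"
  have a: "a > 0" using q by (simp add: a_def)
  have a2: "(1 + q) / (2 * q) = a + 1 / 2" using q by (simp add: a_def field_simps)
  have L: "(\<lambda>m. ln (real m) - (\<Sum>n<m. inverse (z + of_nat n))) \<longlonglongrightarrow> Digamma z" if "z > 0" for z :: real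
    using Digamma_LIMSEQ[of z] that by simp
  have "(\<lambda>m. (ln (real m) - (\<Sum>n<m. inverse (a + 1/2 + of_nat n)))
        - (ln (real m) - (\<Sum>n<m. inverse (a + of_nat n))))
      \<longlonglongrightarrow> Digamma (a + 1/2) - Digamma a"
    using a by (intro tendsto_diff L) auto
  then have "(\<lambda>m. 1 / (2 * q) * ((ln (real m) - (\<Sum>n<m. inverse (a + 1/2 + of_nat n)))
        - (ln (real m) - (\<Sum>n<m. inverse (a + of_nat n))))) \<longlonglongrightarrow> b_const q"
    unfolding b_const_def a2 a_def[symmetric] by (intro tendsto_mult_left)
  moreover have "1 / (2 * q) * ((ln (real m) - (\<Sum>n<m. inverse (a + 1/2 + of_nat n)))
        - (ln (real m) - (\<Sum>n<m. inverse (a + of_nat n))))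
      = (\<Sum>n<2*m. (- 1) ^ n / (real n * q + 1))" for m
  proof -
    have "1 / (2 * q) * inverse (a + real n) = 1 / (real (2*n) * q + 1)"
      "1 / (2 * q) * inverse (a + 1/2 + real n) = 1 / (real (2*n+1) * q + 1)" for n
      using q by (simp_all add: a_def field_simps)
    note terms = this
    have "1 / (2 * q) * ((ln (real m) - (\<Sum>n<m. inverse (a + 1/2 + of_nat n)))
        - (ln (real m) - (\<Sum>n<m. inverse (a + of_nat n))))
      = (\<Sum>n<m. 1 / (2 * q) * inverse (a + real n) - 1 / (2 * q) * inverse (a + 1/2 + real n))"
      by (simp only: sum_subtractf sum_distrib_left[symmetric] right_diff_distrib[symmetric])
        (simp add: algebra_simps)
    also have "\<dots> = (\<Sum>n<2*m. (- 1) ^ n / (real n * q + 1))"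
      unfolding terms by (induction m) simp_all
    finally show ?thesis .
  qed
  ultimately have lim1: "(\<lambda>m. \<Sum>n<2*m. (- 1) ^ n / (real n * q + 1)) \<longlonglongrightarrow> b_const q" by simp
  have "(\<lambda>m. 1 / (2 * real m * q + 1)) \<longlonglongrightarrow> 0"
  proof (rule tendsto_divide_0[OF tendsto_const])
    have "filterlim (\<lambda>m. (2 * q) * real m) at_top sequentially"
      using q by (intro filterlim_tendsto_pos_mult_at_top[OF tendsto_const] filterlim_real_sequentially) auto
    then have "filterlim (\<lambda>m. 1 + 2 * q * real m) at_top sequentially"
      by (rule filterlim_tendsto_add_at_top[OF tendsto_const])
    then show "filterlim (\<lambda>m. 2 * real m * q + 1) at_infinity sequentially"
      by (intro filterlim_at_top_imp_at_infinity) (simp add: mult_ac add_ac)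
  qed
  then have "(\<lambda>m. (\<Sum>n<2*m. (- 1) ^ n / (real n * q + 1)) - arctan_p q 1) \<longlonglongrightarrow> 0"
    by (rule Lim_null_comparison[rotated])
      (use arctan_p_one_partial_sum[OF q] in \<open>auto simp: abs_minus_commute\<close>)
  then have "(\<lambda>m. \<Sum>n<2*m. (- 1) ^ n / (real n * q + 1)) \<longlonglongrightarrow> arctan_p q 1"
    by (simp add: LIM_zero_iff)
  with lim1 show ?thesis by (rule LIMSEQ_unique)
qed

section \<open>The four inequalities\<close>

theorem theorem6:
  fixes p x :: real
  assumes "p > 1" and "0 < x" and "x < 1"
  shows "arctanh_p p x
           < x / 2 * (1 - 2 / p * ln (1 - x powr (p / 2))
               + 2 powr (2 / p) * b_const (p / 2) / (1 + x powr (p / 2)) powr (2 / p))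
       \<and> arctan_p p x
           < x * (1 - 1 / (p * (1 + p)) * ln (1 - x powr p) - 1 / p * ln (1 + x powr p))
       \<and> arctanh_p p x
           > x / 2 * (1 - 2 / (2 + p) * ln (1 - x powr (p / 2))
               + (p * (2 + p) * (1 + x powr (p / 2)) + 4 * x powr (p / 2))
                 / (p * (2 + p) * (1 + x powr (p / 2)) powr (1 + 2 / p)))
       \<and> arctan_p p x
           > x * (1 + 1 / (p * (1 + p)) * ln (1 - x powr p) - 2 / (1 + 2 * p) * ln (1 + x powr p))"
proof (intro conjI)
  have p: "p > 0" and q: "p / 2 > 0" using assms by auto
  note split = arctanh_p_split[OF p less_imp_le[OF assms(2)] assms(3)]
  define u where "u = x powr (p / 2)"
  have u: "u \<ge> 0" by (simp add: u_def)
  have half_sum: "(a + b) / 2 < x / 2 * (c + d)" if "a < x * c" "b < x * d" for a b c d :: real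
  proof -
    have "(a + b) / 2 < (x * c + x * d) / 2" using that by simp
    then show ?thesis by (simp add: algebra_simps)
  qed
  have half_sum': "(a + b) / 2 > x / 2 * (c + d)" if "a > x * c" "b > x * d" for a b c d :: real
  proof -
    have "(a + b) / 2 > (x * c + x * d) / 2" using that by simp
    then show ?thesis by (simp add: algebra_simps)
  qed
  have c0: "1 / (p / 2) = 2 / p" by simp
  show "arctanh_p p x
           < x / 2 * (1 - 2 / p * ln (1 - x powr (p / 2))
               + 2 powr (2 / p) * b_const (p / 2) / (1 + x powr (p / 2)) powr (2 / p))"
    using half_sum[OF arctanh_p_less_ln[OF q assms(2,3)] arctan_p_less_powr[OF q assms(2,3)]]
    unfolding split arctan_p_one_eq_b_const[OF q] c0 .
  have c1: "1 / (1 + p / 2) = 2 / (2 + p)" using p by (simp add: field_simps)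
  have c2: "(1 + u) powr (- 1 / (p / 2)) * (1 + u / (p / 2 * (1 + p / 2) * (1 + u)))
      = (p * (2 + p) * (1 + u) + 4 * u) / (p * (2 + p) * (1 + u) powr (1 + 2 / p))"
  proof -
    have "(1 + u) powr (- 1 / (p / 2)) = 1 / (1 + u) powr (2 / p)"
      using powr_minus_divide[of "1 + u" "2 / p"] by simp
    moreover have "(1 + u) powr (1 + 2 / p) = (1 + u) * (1 + u) powr (2 / p)"
      using u by (simp add: powr_add)
    moreover have "1 + u / (p / 2 * (1 + p / 2) * (1 + u))
        = (p * (2 + p) * (1 + u) + 4 * u) / (p * (2 + p) * (1 + u))"
    proof -
      have "p \<noteq> 0" "2 + p \<noteq> 0" "1 + u \<noteq> 0" using p u by auto
      moreover have "p / 2 * (1 + p / 2) * (1 + u) = p * (2 + p) * (1 + u) / 4"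
        by (simp add: field_simps)
      ultimately show ?thesis by (simp only: add_divide_distrib) simp
    qed
    ultimately show ?thesis by (simp only: times_divide_times_eq) (simp add: mult_ac)
  qed
  show "arctanh_p p x
           > x / 2 * (1 - 2 / (2 + p) * ln (1 - x powr (p / 2))
               + (p * (2 + p) * (1 + x powr (p / 2)) + 4 * x powr (p / 2))
                 / (p * (2 + p) * (1 + x powr (p / 2)) powr (1 + 2 / p)))"
    using half_sum'[OF arctanh_p_greater_ln[OF q assms(2,3)] arctan_p_greater_powr[OF q assms(2)]]
    unfolding split c1 u_def[symmetric] c2 .
qed (use arctan_p_less_ln arctan_p_greater_ln assms in auto)

end
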